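(* Let $(\mathcal{V},\mathcal{TV},\mathcal{L},\ell_0,\mathcal{T})$ be an integer program, $\emptyset\ne\mathcal{T}'\subseteq\mathcal{T}\setminus\mathcal{T}_0$, $t'\in\mathcal{T}'$, let $S_{t',\mathcal{T}'}$ be a local size bound for $t'$ w.r.t. $\mathcal{T}'$, and let $\mathcal{SB}:\mathcal{T}\times\mathcal{V}\to\mathcal{B}$ be a size bound. Let $\mathcal{SB}'(t',x)=\max\{S_{t',\mathcal{T}'}(x)[v/\mathcal{SB}(r,v)\mid v\in\mathcal{V}]\mid r\in\mathcal{E}_{\mathcal{T}'}\}$ for all $x\in\mathcal{V}$ and $\mathcal{SB}'(t,x)=\mathcal{SB}(t,x)$ for all $t\ne t'$. Then $\mathcal{SB}'$ is also a size bound.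
   Context: Integer program: finite disjoint sets $\mathcal{V}$ (program variables), $\mathcal{TV}$ (temporary variables), locations $\mathcal{L}$ with initial $\ell_0$, transitions $(\ell,\varphi,\eta,\ell')$ with $\ell'\ne\ell_0$, guard built with $\wedge,\vee$ from atoms $p_1<p_2$ over $\mathbb{Z}[\mathcal{V}\cup\mathcal{TV}]$, update $\eta:\mathcal{V}\to\mathbb{Z}[\mathcal{V}\cup\mathcal{TV}]$; $\mathcal{T}_0$ the transitions from $\ell_0$. States $\sigma:\mathcal{V}\cup\mathcal{TV}\to\mathbb{Z}$, $|\sigma|(v)=|\sigma(v)|$; $(\ell,\sigma)\to_t(\ell',\sigma')$ iff $t=(\ell,\varphi,\eta,\ell')$, $\sigma(\varphi)$ holds and $\sigma'(v)=\sigma(\eta(v))$ for $v\in\mathcal{V}$. Bounds $\mathcal{B}$: smallest set containing $\mathbb{R}_{\ge0}\cup\{\omega\}$ and variables, closed under $+,\cdot,k^b,\log_k(\max\{1,b\}),\max$ ($k>1$). $\mathcal{SB}$ is a size bound if $|\sigma_0|(\mathcal{SB}(t,v))\ge\sup\{|\sigma'(v)|\mid\exists\ell'.(\ell_0,\sigma_0)(\to^*_{\mathcal{T}}\circ\to_t)(\ell',\sigma')\}$ for all $t,v,\sigma_0$. Entry transitions $\mathcal{E}_{\mathcal{T}'}$: $t=(\_,\_,\_,\ell)\in\mathcal{T}\setminus\mathcal{T}'$ with some transition of $\mathcal{T}'$ starting in $\ell$. $S_{t',\mathcal{T}'}:\mathcal{V}\to\mathcal{B}$ is a local size bound for $t'$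 w.r.t. $\mathcal{T}'$ if for all $v\in\mathcal{V}$, $\sigma$: $|\sigma|(S_{t',\mathcal{T}'}(v))\ge\sup\{|\sigma'(v)|\mid\exists\ell'\in\mathcal{L},(\_,\_,\_,\ell)\in\mathcal{E}_{\mathcal{T}'}.\ (\ell,\sigma)(\to^*_{\mathcal{T}'}\circ\to_{t'})(\ell',\sigma')\}$. $b[v/b_v]$ replaces each variable $v$ by $b_v$. *)

theory Defs
  imports
    "HOL-Library.Poly_Mapping"
    "HOL-Library.FuncSet"
    "HOL-Library.FSet"
    "HOL-Library.Extended_Nonnegative_Real"
    Complex_Main
begin

section \<open>Integer programs\<close>

text \<open>
  A polynomial with integer coefficients maps each monomial (a finitely supported map from
  variables to exponents) to its coefficient.
\<close>

type_synonym 'v ipoly = "('v \<Rightarrow>\<^sub>0 nat) \<Rightarrow>\<^sub>0 int"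

definition poly_vars :: "'v ipoly \<Rightarrow> 'v set" where
  "poly_vars p = (\<Union>m\<in>Poly_Mapping.keys p. Poly_Mapping.keys m)"

definition ipolys :: "'v set \<Rightarrow> 'v ipoly set" where
  "ipolys X = {p. poly_vars p \<subseteq> X}"

text \<open>
  A state of a program over the variables \<open>V \<union> TV\<close> is represented by a total function. Its values
  outside \<open>V \<union> TV\<close> are never read and, like those on \<open>TV\<close>, never constrained by a step.
\<close>

type_synonym 'v state = "'v \<Rightarrow> int"

definition poly_eval :: "'v state \<Rightarrow> 'v ipoly \<Rightarrow> int" where
  "poly_eval \<sigma> p = (\<Sum>m\<in>Poly_Mapping.keys p.
     Poly_Mapping.lookup p m * (\<Prod>v\<in>Poly_Mapping.keys m. \<sigma> v ^ Poly_Mapping.lookup m v))"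

datatype 'v guard =
    Less "'v ipoly" "'v ipoly"
  | And "'v guard" "'v guard"
  | Or "'v guard" "'v guard"

primrec guard_over_vars :: "'v set \<Rightarrow> 'v guard \<Rightarrow> bool" where
  "guard_over_vars X (Less p q) \<longleftrightarrow> p \<in> ipolys X \<and> q \<in> ipolys X"
| "guard_over_vars X (And \<phi> \<psi>) \<longleftrightarrow> guard_over_vars X \<phi> \<and> guard_over_vars X \<psi>"
| "guard_over_vars X (Or \<phi> \<psi>) \<longleftrightarrow> guard_over_vars X \<phi> \<and> guard_over_vars X \<psi>"

primrec guard_holds :: "'v state \<Rightarrow> 'v guard \<Rightarrow> bool" where
  "guard_holds \<sigma> (Less p q) \<longleftrightarrow> poly_eval \<sigma> p < poly_eval \<sigma> q"
| "guard_holds \<sigma> (And \<phi> \<psi>) \<longleftrightarrow> guard_holds \<sigma> \<phi> \<and> guard_holds \<sigma> \<psi>"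
| "guard_holds \<sigma> (Or \<phi> \<psi>) \<longleftrightarrow> guard_holds \<sigma> \<phi> \<or> guard_holds \<sigma> \<psi>"

datatype ('l, 'v) transition =
  Transition (source: 'l) (guard: "'v guard") (update: "'v \<Rightarrow> 'v ipoly") (target: 'l)

locale integer_program =
  fixes V TV :: "'v set" and L :: "'l set" and l0 :: 'l and T :: "('l, 'v) transition set"
  assumes finite_V: "finite V"
    and finite_TV: "finite TV"
    and disjoint: "V \<inter> TV = {}"
    and finite_L: "finite L"
    and initial: "l0 \<in> L"
    and finite_T: "finite T"
    and source_in: "t \<in> T \<Longrightarrow> source t \<in> L"
    and target_in: "t \<in> T \<Longrightarrow> target t \<in> L - {l0}"
    and guard_over: "t \<in> T \<Longrightarrow> guard_over_vars (V \<union> TV) (guard t)"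
    and update_over: "t \<in> T \<Longrightarrow> update t \<in> V \<rightarrow>\<^sub>E ipolys (V \<union> TV)"

definition initial_transitions :: "'l \<Rightarrow> ('l, 'v) transition set \<Rightarrow> ('l, 'v) transition set" where
  "initial_transitions l0 T = {t \<in> T. source t = l0}"

definition entry_transitions ::
    "('l, 'v) transition set \<Rightarrow> ('l, 'v) transition set \<Rightarrow> ('l, 'v) transition set" where
  "entry_transitions T T' = {r \<in> T - T'. \<exists>t\<in>T'. source t = target r}"

type_synonym ('l, 'v) config = "'l \<times> 'v state"

definition step ::
    "'v set \<Rightarrow> ('l, 'v) transition \<Rightarrow> ('l, 'v) config \<Rightarrow> ('l, 'v) config \<Rightarrow> bool" where
  "step V t = (\<lambda>(l, \<sigma>) (l', \<sigma>').
     source t = l \<and> target t = l' \<and> guard_holds \<sigma> (guard t) \<and>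
     (\<forall>v\<in>V. \<sigma>' v = poly_eval \<sigma> (update t v)))"

definition steps ::
    "'v set \<Rightarrow> ('l, 'v) transition set \<Rightarrow> ('l, 'v) config \<Rightarrow> ('l, 'v) config \<Rightarrow> bool" where
  "steps V T c c' \<longleftrightarrow> (\<exists>t\<in>T. step V t c c')"


section \<open>Bounds\<close>

text \<open>
  The constants range over the nonnegative reals and \<open>\<omega>\<close>, which is \<open>\<infinity> :: ennreal\<close>; in
  particular \<open>0 \<cdot> \<omega> = 0\<close>, which keeps multiplication monotone.
  \<open>BLog k b\<close> stands for the logarithm of \<open>max {1, b}\<close> to base \<open>k\<close>. The maximum is taken over an
  arbitrary finite set of bounds; the empty maximum has the value \<open>0\<close>.
\<close>

datatype 'v bound =
    BConst ennreal
  | BVar 'v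
  | BAdd "'v bound" "'v bound"
  | BMult "'v bound" "'v bound"
  | BExp real "'v bound"
  | BLog real "'v bound"
  | BMax "'v bound fset"

inductive_set bounds :: "'v set \<Rightarrow> 'v bound set" for V :: "'v set" where
  "BConst c \<in> bounds V"
| "v \<in> V \<Longrightarrow> BVar v \<in> bounds V"
| "b1 \<in> bounds V \<Longrightarrow> b2 \<in> bounds V \<Longrightarrow> BAdd b1 b2 \<in> bounds V"
| "b1 \<in> bounds V \<Longrightarrow> b2 \<in> bounds V \<Longrightarrow> BMult b1 b2 \<in> bounds V"
| "k > 1 \<Longrightarrow> b \<in> bounds V \<Longrightarrow> BExp k b \<in> bounds V"
| "k > 1 \<Longrightarrow> b \<in> bounds V \<Longrightarrow> BLog k b \<in> bounds V"
| "(\<And>b. b \<in> fset B \<Longrightarrow> b \<in> bounds V) \<Longrightarrow> BMax B \<in> bounds V"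

primrec bound_eval :: "('v \<Rightarrow> ennreal) \<Rightarrow> 'v bound \<Rightarrow> ennreal" where
  "bound_eval \<alpha> (BConst c) = c"
| "bound_eval \<alpha> (BVar v) = \<alpha> v"
| "bound_eval \<alpha> (BAdd b1 b2) = bound_eval \<alpha> b1 + bound_eval \<alpha> b2"
| "bound_eval \<alpha> (BMult b1 b2) = bound_eval \<alpha> b1 * bound_eval \<alpha> b2"
| "bound_eval \<alpha> (BExp k b) =
     (if bound_eval \<alpha> b = \<infinity> then \<infinity> else ennreal (k powr enn2real (bound_eval \<alpha> b)))"
| "bound_eval \<alpha> (BLog k b) =
     (if bound_eval \<alpha> b = \<infinity> then \<infinity> else ennreal (log k (max 1 (enn2real (bound_eval \<alpha> b)))))"
| "bound_eval \<alpha> (BMax B) = Sup (fset (bound_eval \<alpha> |`| B))"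

primrec bound_subst :: "('v \<Rightarrow> 'v bound) \<Rightarrow> 'v bound \<Rightarrow> 'v bound" where
  "bound_subst s (BConst c) = BConst c"
| "bound_subst s (BVar v) = s v"
| "bound_subst s (BAdd b1 b2) = BAdd (bound_subst s b1) (bound_subst s b2)"
| "bound_subst s (BMult b1 b2) = BMult (bound_subst s b1) (bound_subst s b2)"
| "bound_subst s (BExp k b) = BExp k (bound_subst s b)"
| "bound_subst s (BLog k b) = BLog k (bound_subst s b)"
| "bound_subst s (BMax B) = BMax (bound_subst s |`| B)"

text \<open>Only meaningful for finite sets of bounds.\<close>

definition bound_Max :: "'v bound set \<Rightarrow> 'v bound" where
  "bound_Max B = BMax (Abs_fset B)"

definition abs_state :: "'v state \<Rightarrow> 'v \<Rightarrow> ennreal" where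
  "abs_state \<sigma> v = ennreal (real_of_int \<bar>\<sigma> v\<bar>)"


section \<open>Size bounds\<close>

definition is_size_bound ::
    "'v set \<Rightarrow> 'l \<Rightarrow> ('l, 'v) transition set \<Rightarrow> (('l, 'v) transition \<Rightarrow> 'v \<Rightarrow> 'v bound) \<Rightarrow> bool" where
  "is_size_bound V l0 T SB \<longleftrightarrow>
     (\<forall>t\<in>T. \<forall>v\<in>V. SB t v \<in> bounds V \<and>
       (\<forall>\<sigma>0. bound_eval (abs_state \<sigma>0) (SB t v) \<ge>
          Sup {abs_state \<sigma>' v |\<sigma>'. \<exists>l'. ((steps V T)\<^sup>*\<^sup>* OO step V t) (l0, \<sigma>0) (l', \<sigma>')}))"

definition is_local_size_bound ::
    "'v set \<Rightarrow> 'l set \<Rightarrow> ('l, 'v) transition set \<Rightarrow> ('l, 'v) transition set \<Rightarrow> ('l, 'v) transition \<Rightarrow>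
     ('v \<Rightarrow> 'v bound) \<Rightarrow> bool" where
  "is_local_size_bound V L T T' t' S \<longleftrightarrow>
     (\<forall>v\<in>V. S v \<in> bounds V \<and>
       (\<forall>\<sigma>. bound_eval (abs_state \<sigma>) (S v) \<ge>
          Sup {abs_state \<sigma>' v |\<sigma>'. \<exists>l'\<in>L. \<exists>r\<in>entry_transitions T T'.
                 ((steps V T')\<^sup>*\<^sup>* OO step V t') (target r, \<sigma>) (l', \<sigma>')}))"

end

theory Submission
  imports Defs
begin

text \<open>
  A run that ends with \<open>t'\<close> starts outside \<open>T'\<close>, since no transition of \<open>T'\<close> is initial. Cut it
  after its last transition \<open>r\<close> outside \<open>T'\<close>: what follows stays in \<open>T'\<close>, so \<open>r\<close> is an entry
  transition. The state \<open>\<sigma>\<close> reached by \<open>r\<close> is bounded by \<open>SB r\<close>, and the rest of the run is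
  bounded by \<open>S\<close> in terms of \<open>\<sigma>\<close>. As bounds are weakly monotone, the two estimates compose, and
  evaluating the composition is evaluating the substitution.
\<close>

lemma bound_eval_subst:
  "bound_eval \<alpha> (bound_subst s b) = bound_eval (\<lambda>v. bound_eval \<alpha> (s v)) b"
proof (induction b)
  case (BMax B)
  then have "(\<lambda>b. bound_eval \<alpha> (bound_subst s b)) ` fset B =
      bound_eval (\<lambda>v. bound_eval \<alpha> (s v)) ` fset B"
    by (intro image_cong) auto
  then show ?case
    by (simp add: image_image)
qed auto

lemma bound_subst_in_bounds:
  assumes "b \<in> bounds V" and "\<And>v. v \<in> V \<Longrightarrow> s v \<in> bounds W"
  shows "bound_subst s b \<in> bounds W"
  using assms by (induction rule: bounds.induct) (auto intro: bounds.intros)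

text \<open>Every constructor is weakly monotone on \<open>ennreal\<close>: products because 0 times
  infinity is 0, powers and logarithms because the base exceeds 1. A comparison on \<open>V\<close>
  alone is enough, as elements of \<open>bounds V\<close> mention no other variables.\<close>

lemma bound_eval_mono:
  assumes "b \<in> bounds V" and le: "\<And>v. v \<in> V \<Longrightarrow> \<alpha> v \<le> \<beta> v"
  shows "bound_eval \<alpha> b \<le> bound_eval \<beta> b"
  using assms(1)
proof (induction rule: bounds.induct)
  case (5 k b)
  then show ?case
    by (auto simp: less_top top_unique intro!: ennreal_leI powr_mono enn2real_mono)
next
  case (6 k b)
  \<comment> \<open>\<open>enn2real\<close> maps infinity to 0, so it is monotone only below a
    finite value. If the larger argument is infinite, the claim is trivial.\<close>
  have "log k (max 1 (enn2real (bound_eval \<alpha> b))) \<le> log k (max 1 (enn2real (bound_eval \<beta> b)))"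
    if "bound_eval \<beta> b \<noteq> \<infinity>"
  proof -
    have "enn2real (bound_eval \<alpha> b) \<le> enn2real (bound_eval \<beta> b)"
      using 6 that by (auto simp: less_top intro: enn2real_mono)
    then have "max 1 (enn2real (bound_eval \<alpha> b)) \<le> max 1 (enn2real (bound_eval \<beta> b))"
      by linarith
    then show ?thesis
      using 6 by simp
  qed
  with 6 show ?case
    by (auto simp: top_unique intro!: ennreal_leI)
next
  case (7 B)
  then show ?case
    by (auto intro!: SUP_mono)
qed (auto intro: le add_mono mult_mono)

text \<open>\<open>Abs_fset\<close> is unspecified on infinite sets, so the facts about
  \<open>bound_Max\<close> all assume finiteness.\<close>

lemma fset_Abs_fset: "finite B \<Longrightarrow> fset (Abs_fset B) = B"
  by (simp add: Abs_fset_inverse)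

lemma bound_Max_in_bounds:
  "finite B \<Longrightarrow> B \<subseteq> bounds V \<Longrightarrow> bound_Max B \<in> bounds V"
  unfolding bound_Max_def by (rule bounds.intros) (auto simp: fset_Abs_fset)

lemma bound_eval_le_bound_Max:
  "finite B \<Longrightarrow> b \<in> B \<Longrightarrow> bound_eval \<alpha> b \<le> bound_eval \<alpha> (bound_Max B)"
  unfolding bound_Max_def by (auto simp: fset_Abs_fset intro: SUP_upper)

lemma is_size_boundD:
  assumes "is_size_bound V l0 T SB" and "t \<in> T" and "v \<in> V"
    and "((steps V T)\<^sup>*\<^sup>* OO step V t) (l0, \<sigma>0) (l', \<sigma>')"
  shows "abs_state \<sigma>' v \<le> bound_eval (abs_state \<sigma>0) (SB t v)"
  using assms unfolding is_size_bound_def Sup_le_iff by blast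

lemma is_local_size_boundD:
  assumes "is_local_size_bound V L T T' t' S" and "r \<in> entry_transitions T T'" and "v \<in> V"
    and "l' \<in> L" and "((steps V T')\<^sup>*\<^sup>* OO step V t') (target r, \<sigma>) (l', \<sigma>')"
  shows "abs_state \<sigma>' v \<le> bound_eval (abs_state \<sigma>) (S v)"
  using assms unfolding is_local_size_bound_def Sup_le_iff by blast

text \<open>By induction on the run, extended at its end: a last step in \<open>T'\<close> prolongs
  the suffix after \<open>r\<close>, any other last step becomes the new \<open>r\<close> with an
  empty suffix. The condition on \<open>c0\<close> rules out the empty run.\<close>

lemma run_through_entry_transition:
  assumes "(steps V T)\<^sup>*\<^sup>* c0 c" and "fst c \<in> source ` T'" and "fst c0 \<notin> source ` T'"
  obtains r \<sigma> where "r \<in> entry_transitions T T'"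
    and "((steps V T)\<^sup>*\<^sup>* OO step V r) c0 (target r, \<sigma>)"
    and "(steps V T')\<^sup>*\<^sup>* (target r, \<sigma>) c"
proof -
  have "\<exists>r\<in>entry_transitions T T'. \<exists>\<sigma>. ((steps V T)\<^sup>*\<^sup>* OO step V r) c0 (target r, \<sigma>) \<and>
      (steps V T')\<^sup>*\<^sup>* (target r, \<sigma>) c"
    \<comment> \<open>The condition on \<open>c\<close> is carried through the induction, since it
      must be re-established at each earlier configuration.\<close>
    using assms(1,2)
  proof (induction rule: rtranclp_induct)
    case base
    with assms(3) show ?case by simp
  next
    case (step c d)
    from step.hyps(2) obtain t where t: "t \<in> T" "step V t c d"
      by (auto simp: steps_def)
    then have source: "fst c = source t" and target: "fst d = target t"
      by (auto simp: step_def split: prod.splits)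
    show ?case
    proof (cases "t \<in> T'")
      case True
      \<comment> \<open>The step \<open>t\<close> of \<open>T'\<close> leaves from \<open>c\<close>,
        which is the premise that the induction hypothesis asks of \<open>c\<close>.\<close>
      with source step.IH obtain r \<sigma> where
        "r \<in> entry_transitions T T'" "((steps V T)\<^sup>*\<^sup>* OO step V r) c0 (target r, \<sigma>)"
        "(steps V T')\<^sup>*\<^sup>* (target r, \<sigma>) c"
        by auto
      moreover have "steps V T' c d"
        using True t by (auto simp: steps_def)
      ultimately show ?thesis
        by (meson rtranclp.rtrancl_into_rtrancl)
    next
      case False
      with t step.prems target have "t \<in> entry_transitions T T'"
        by (auto simp: entry_transitions_def)
      moreover have "d = (target t, snd d)"
        using target by (metis prod.collapse)
      moreover have "((steps V T)\<^sup>*\<^sup>* OO step V t) c0 d"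
        using step.hyps(1) t(2) by blast
      ultimately show ?thesis
        by (metis rtranclp.rtrancl_refl)
    qed
  qed
  with that show thesis by blast
qed

theorem theorem7:
  fixes V TV :: "'v set" and L :: "'l set" and l0 :: 'l
    and T T' :: "('l, 'v) transition set" and t' :: "('l, 'v) transition"
    and S :: "'v \<Rightarrow> 'v bound" and SB SB' :: "('l, 'v) transition \<Rightarrow> 'v \<Rightarrow> 'v bound"
  assumes "integer_program V TV L l0 T"
    and "T' \<noteq> {}"
    and "T' \<subseteq> T - initial_transitions l0 T"
    and "t' \<in> T'"
    and "is_local_size_bound V L T T' t' S"
    and "is_size_bound V l0 T SB"
    and "\<And>x. x \<in> V \<Longrightarrow>
           SB' t' x = bound_Max {bound_subst (SB r) (S x) |r. r \<in> entry_transitions T T'}"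
    and "\<And>t x. t \<in> T \<Longrightarrow> t \<noteq> t' \<Longrightarrow> x \<in> V \<Longrightarrow> SB' t x = SB t x"
  shows "is_size_bound V l0 T SB'"
proof -
  interpret integer_program V TV L l0 T by fact
  let ?E = "entry_transitions T T'"
  have ET: "r \<in> T" if "r \<in> ?E" for r
    using that by (simp add: entry_transitions_def)
  have t'T: "t' \<in> T" and l0: "l0 \<notin> source ` T'"
    using assms(3,4) by (auto simp: initial_transitions_def)
  have S: "S x \<in> bounds V" if "x \<in> V" for x
    using assms(5) that by (simp add: is_local_size_bound_def)
  have SB: "SB t x \<in> bounds V" if "t \<in> T" "x \<in> V" for t x
    using assms(6) that by (simp add: is_size_bound_def)
  have "finite ?E"
    using finite_T by (simp add: entry_transitions_def)
  then have fin: "finite {bound_subst (SB r) (S x) |r. r \<in> ?E}" for x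
    by simp
  have bounds: "SB' t' x \<in> bounds V" if "x \<in> V" for x
    unfolding assms(7)[OF that]
    using fin S[OF that] SB ET by (auto intro!: bound_Max_in_bounds bound_subst_in_bounds)
  have le: "abs_state \<sigma>' x \<le> bound_eval (abs_state \<sigma>0) (SB' t' x)"
    if x: "x \<in> V" and run: "((steps V T)\<^sup>*\<^sup>* OO step V t') (l0, \<sigma>0) (l', \<sigma>')" for x \<sigma>0 l' \<sigma>'
  proof -
    from run obtain c where c: "(steps V T)\<^sup>*\<^sup>* (l0, \<sigma>0) c" "step V t' c (l', \<sigma>')"
      by blast
    from c(2) have "fst c = source t'" "l' = target t'"
      by (auto simp: step_def split: prod.splits)
    with assms(4) t'T target_in have "fst c \<in> source ` T'" and l': "l' \<in> L"
      by auto
    have "fst (l0, \<sigma>0) \<notin> source ` T'"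
      using l0 by simp
    with c(1) \<open>fst c \<in> source ` T'\<close> obtain r \<sigma> where r: "r \<in> ?E"
      and to_r: "((steps V T)\<^sup>*\<^sup>* OO step V r) (l0, \<sigma>0) (target r, \<sigma>)"
      and from_r: "(steps V T')\<^sup>*\<^sup>* (target r, \<sigma>) c"
      by (rule run_through_entry_transition)
    have "abs_state \<sigma>' x \<le> bound_eval (abs_state \<sigma>) (S x)"
      using is_local_size_boundD[OF assms(5) r x l'] from_r c(2) by blast
    \<comment> \<open>\<open>SB r\<close> controls \<sigma> only on \<open>V\<close>; the values of
      temporary variables after a step are arbitrary. This suffices because \<open>S x\<close> lies
      in \<open>bounds V\<close>.\<close>
    also have "\<dots> \<le> bound_eval (\<lambda>v. bound_eval (abs_state \<sigma>0) (SB r v)) (S x)"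
      using S[OF x] is_size_boundD[OF assms(6) ET[OF r] _ to_r] by (rule bound_eval_mono)
    also have "\<dots> = bound_eval (abs_state \<sigma>0) (bound_subst (SB r) (S x))"
      by (simp add: bound_eval_subst)
    \<comment> \<open>The maximum includes the term of \<open>r\<close>. With no entry transition it
      would be 0, but then no run could end with \<open>t'\<close>.\<close>
    also have "\<dots> \<le> bound_eval (abs_state \<sigma>0) (SB' t' x)"
      unfolding assms(7)[OF x] using fin r by (intro bound_eval_le_bound_Max) auto
    finally show ?thesis .
  qed
  show ?thesis
    unfolding is_size_bound_def
  proof (intro ballI)
    fix t v assume t: "t \<in> T" and v: "v \<in> V"
    show "SB' t v \<in> bounds V \<and>
       (\<forall>\<sigma>0. bound_eval (abs_state \<sigma>0) (SB' t v) \<ge>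
          Sup {abs_state \<sigma>' v |\<sigma>'. \<exists>l'. ((steps V T)\<^sup>*\<^sup>* OO step V t) (l0, \<sigma>0) (l', \<sigma>')})"
    proof (cases "t = t'")
      case True
      with bounds[OF v] le[OF v] show ?thesis
        by (auto simp del: relcompp_apply intro!: Sup_least)
    next
      case False
      with assms(6) t v show ?thesis
        by (simp add: assms(8) is_size_bound_def)
    qed
  qed
qed

end
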